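(* Let $T$ be a tree of order $n\geq 2$. Then \[\gamma_{LD}(T)\leq\frac{n+\ell(T)-s(T)-sl(T)}{2}.\]
   Context: For an undirected graph $G=(V,E)$, $S\subseteq V$ is a locating-dominating set if every $u\notin S$ has $N(u)\cap S\neq\emptyset$ and distinct $u,v\notin S$ satisfy $N(u)\cap S\neq N(v)\cap S$; $\gamma_{LD}(G)$ is the minimum size. A leaf is a vertex of degree 1; a support vertex is a vertex adjacent to a leaf; a support link is a vertex that is neither a leaf nor a support vertex and all of whose neighbours are support vertices. $\ell(T)$, $s(T)$, $sl(T)$ denote the numbers of leaves, support vertices and support links of $T$. By convention, for the path $P_2$ one of its vertices is considered a support vertex and the other a leaf. *)

theory Defs
  imports "Graph_Theory.Graph_Theory"
begin

text \<open>
  A finite simple undirected graph is a \<open>pair_graph\<close>: each undirected edge is represented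
  by its two opposite arcs. The predicate \<open>tree\<close> of the library is unsuitable here, because
  its cycles include the back-and-forth walks \<open>a, b, a\<close>, so that no such graph with an edge
  satisfies it. The cycles of an undirected simple graph are those of length at least 3.
\<close>

definition undirected_tree :: "'a pair_pre_digraph \<Rightarrow> bool" where
  "undirected_tree G \<longleftrightarrow>
     pair_graph G \<and> Digraph_Component.connected (with_proj G) \<and>
     \<not> (\<exists>p. pre_digraph.cycle (with_proj G) p \<and> length p \<ge> 3)"

definition nbhd :: "'a pair_pre_digraph \<Rightarrow> 'a \<Rightarrow> 'a set" where
  "nbhd G u = {v. (u, v) \<in> parcs G}"

definition locating_dominating :: "'a pair_pre_digraph \<Rightarrow> 'a set \<Rightarrow> bool" where
  "locating_dominating G S \<longleftrightarrow>
     S \<subseteq> pverts G \<and>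
     (\<forall>u \<in> pverts G - S. nbhd G u \<inter> S \<noteq> {}) \<and>
     (\<forall>u \<in> pverts G - S. \<forall>v \<in> pverts G - S. u \<noteq> v \<longrightarrow> nbhd G u \<inter> S \<noteq> nbhd G v \<inter> S)"

definition ld_number :: "'a pair_pre_digraph \<Rightarrow> nat" where
  "ld_number G = (LEAST k. \<exists>S. locating_dominating G S \<and> card S = k)"

text \<open>
  The last conjunct only matters for the path on two vertices, where by convention exactly
  one of the two vertices of degree 1 is a leaf (and the other one is its support vertex).
\<close>

definition leaves :: "'a pair_pre_digraph \<Rightarrow> 'a set" where
  "leaves G = {u \<in> pverts G. card (nbhd G u) = 1 \<and>
     (card (pverts G) = 2 \<longrightarrow> u \<noteq> (SOME v. v \<in> pverts G))}"

definition support_vertices :: "'a pair_pre_digraph \<Rightarrow> 'a set" where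
  "support_vertices G = {v \<in> pverts G. \<exists>u \<in> leaves G. (v, u) \<in> parcs G}"

definition support_links :: "'a pair_pre_digraph \<Rightarrow> 'a set" where
  "support_links G = {v \<in> pverts G. v \<notin> leaves G \<and> v \<notin> support_vertices G \<and>
     nbhd G v \<subseteq> support_vertices G}"

end

theory Submission
  imports Defs
begin

text \<open>
  Let \<open>U\<close> be the set of support vertices, \<open>K\<close> the set of leaves with one leaf per support vertex
  left out, and \<open>R\<close> the set of vertices that are neither leaves, nor support vertices, nor support
  links. A tree is bipartite; let \<open>D\<close> be the smaller of the two colour classes inside \<open>R\<close>, and
  \<open>S = U \<union> K \<union> D\<close>. No vertex of \<open>R\<close> is adjacent to a leaf or to a support link, so every vertex
  outside \<open>S\<close> has its whole neighbourhood inside \<open>S\<close>. Since a tree has no 4-cycle, a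
  neighbourhood with at least two vertices determines its vertex; the only vertices of degree 1
  outside \<open>S\<close> are the left-out leaves, one per support vertex. Finally
  \<open>n = \<bar>U\<bar> + \<ell> + sl + \<bar>R\<bar>\<close> gives \<open>\<bar>S\<bar> \<le> \<ell> + \<bar>R\<bar> / 2 = (n + \<ell> - s - sl) / 2\<close>.
\<close>

section \<open>Acyclic symmetric relations are bipartite\<close>

text \<open>Each vertex is listed once and the closing arc runs from the last to the first. Length
  at least 3 rules out going back and forth along one edge. Working with a bare relation makes
  deleting an edge simple.\<close>

definition cycle_list :: "'a rel \<Rightarrow> 'a list \<Rightarrow> bool" where
  "cycle_list E xs \<longleftrightarrow> distinct xs \<and> length xs \<ge> 3 \<and>
     successively (\<lambda>x y. (x, y) \<in> E) xs \<and> (last xs, hd xs) \<in> E"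

lemma cycle_list_mono: "cycle_list E xs \<Longrightarrow> E \<subseteq> F \<Longrightarrow> cycle_list F xs"
  unfolding cycle_list_def
  using successively_mono[of "\<lambda>x y. (x, y) \<in> E" xs "\<lambda>x y. (x, y) \<in> F"] by blast

lemma rtrancl_imp_simple_path:
  assumes "(u, v) \<in> E\<^sup>*"
  shows "\<exists>xs. xs \<noteq> [] \<and> hd xs = u \<and> last xs = v \<and> distinct xs \<and>
    successively (\<lambda>x y. (x, y) \<in> E) xs"
  using assms
proof (induction rule: converse_rtrancl_induct)
  case base
  show ?case by (rule exI[of _ "[v]"]) simp
next
  case (step y z)
  then obtain xs where xs: "xs \<noteq> []" "hd xs = z" "last xs = v" "distinct xs"
    "successively (\<lambda>x y. (x, y) \<in> E) xs" by blast
  show ?case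
  proof (cases "y \<in> set xs")
    case True
    then obtain as bs where "xs = as @ y # bs" by (meson split_list)
    \<comment> \<open>The path from \<open>z\<close> already visits \<open>y\<close>, so its suffix
      starting at \<open>y\<close> is the simple path.\<close>
    with xs show ?thesis
      by (intro exI[of _ "y # bs"]) (auto simp: successively_append_iff)
  next
    case False
    with xs step.hyps show ?thesis
      by (intro exI[of _ "y # xs"]) (auto simp: successively_Cons)
  qed
qed

text \<open>Induction on the arc set: delete an edge \<open>uv\<close>, colour the rest, and if the
  ends agree, swap the colours on the component of \<open>v\<close>. Connectedness would not survive
  the deletion, so the statement is about forests.\<close>

lemma acyclic_imp_two_colourable:
  assumes "finite E" "sym E" "irrefl E" "\<nexists>xs. cycle_list E xs"
  shows "\<exists>c :: 'a \<Rightarrow> bool. \<forall>(x, y) \<in> E. c x \<noteq> c y"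
  using assms
proof (induction E rule: finite_psubset_induct)
  case (psubset E)
  show ?case
  proof (cases "E = {}")
    case False
    then obtain u v where uv: "(u, v) \<in> E" by auto
    then have vu: "(v, u) \<in> E" and "u \<noteq> v"
      using psubset.prems by (auto dest: symD simp: irrefl_def)
    define F where "F = E - {(u, v), (v, u)}"
    have "F \<subset> E" "sym F" "irrefl F"
      using psubset.prems uv by (auto simp: F_def sym_def irrefl_def)
    moreover have "\<nexists>xs. cycle_list F xs"
      using psubset.prems(3) cycle_list_mono[of F _ E] \<open>F \<subset> E\<close> by blast
    ultimately have "\<exists>c :: 'a \<Rightarrow> bool. \<forall>(x, y) \<in> F. c x \<noteq> c y"
      by (intro psubset.IH)
    then obtain c :: "'a \<Rightarrow> bool" where "\<forall>(x, y) \<in> F. c x \<noteq> c y" ..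
    then have c: "c x \<noteq> c y" if "(x, y) \<in> F" for x y
      using that by auto
    have unreachable: "(v, u) \<notin> F\<^sup>*"
    proof
      assume "(v, u) \<in> F\<^sup>*"
      then obtain xs where xs: "xs \<noteq> []" "hd xs = v" "last xs = u" "distinct xs"
        "successively (\<lambda>x y. (x, y) \<in> F) xs"
        by (blast dest: rtrancl_imp_simple_path)
      \<comment> \<open>A path with one vertex would force \<open>u = v\<close>, and one with two
        vertices would use the deleted arc \<open>(v, u)\<close>.\<close>
      have "length xs \<ge> 3"
      proof (rule ccontr)
        assume "\<not> length xs \<ge> 3"
        then consider x where "xs = [x]" | x y where "xs = [x, y]"
          using \<open>xs \<noteq> []\<close> by (cases xs; cases "tl xs"; cases "tl (tl xs)") auto
        then show False
          using xs \<open>u \<noteq> v\<close> by cases (auto simp: F_def)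
      qed
      moreover have "successively (\<lambda>x y. (x, y) \<in> E) xs"
        using xs(5) by (rule successively_mono) (simp add: F_def)
      ultimately have "cycle_list E xs"
        using xs uv by (simp add: cycle_list_def)
      with psubset.prems show False by blast
    qed
    show ?thesis
    proof (cases "c u = c v")
      case True
      \<comment> \<open>Swap the colours exactly on the \<open>F\<close>-component of
        \<open>v\<close>, which does not contain \<open>u\<close>. By symmetry of \<open>F\<close>,
        both ends of an arc of \<open>F\<close> are swapped or neither is.\<close>
      define c' where "c' x \<longleftrightarrow> (c x \<noteq> ((v, x) \<in> F\<^sup>*))" for x
      have "c' x \<noteq> c' y" if "(x, y) \<in> F" for x y
      proof -
        have "(v, x) \<in> F\<^sup>* \<longleftrightarrow> (v, y) \<in> F\<^sup>*"
          using that \<open>sym F\<close> by (meson rtrancl.rtrancl_into_rtrancl symD)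
        with c[OF that] show ?thesis by (auto simp: c'_def)
      qed
      moreover have "c' u \<noteq> c' v"
        using True unreachable by (auto simp: c'_def)
      ultimately have "\<forall>(x, y) \<in> E. c' x \<noteq> c' y"
        by (auto simp: F_def)
      then show ?thesis by (intro exI[of _ c'])
    next
      case False
      with c have "\<forall>(x, y) \<in> E. c x \<noteq> c y"
        by (auto simp: F_def)
      then show ?thesis by (intro exI[of _ c])
    qed
  qed simp
qed

section \<open>Trees\<close>

text \<open>Walks and cycles of the graph library are lists of arcs; \<open>zip xs (tl xs)\<close>
  turns a vertex list into such a walk.\<close>

lemma pcas_zip_tl: "xs \<noteq> [] \<Longrightarrow> pcas (hd xs) (zip xs (tl xs)) (last xs)"
  by (induction xs rule: induct_list012) auto

lemma pawalk_verts_zip_tl: "xs \<noteq> [] \<Longrightarrow> pawalk_verts (hd xs) (zip xs (tl xs)) = xs"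
  by (induction xs rule: induct_list012) auto

lemma set_zip_tl_subset:
  "successively (\<lambda>x y. (x, y) \<in> E) xs \<Longrightarrow> set (zip xs (tl xs)) \<subseteq> E"
  by (induction xs rule: induct_list012) auto

context
  fixes T :: "'a pair_pre_digraph"
  assumes tree: "undirected_tree T"
begin

interpretation pair_graph T
  using tree by (simp add: undirected_tree_def)

lemma tree_sym: "(u, v) \<in> parcs T \<Longrightarrow> (v, u) \<in> parcs T"
  using pair_sym_arcs by (auto simp: symmetric_def dest: symD)

lemma tree_irrefl: "(u, u) \<notin> parcs T"
  using pair_no_loops by fastforce

lemma tree_no_cycle_list: "\<not> cycle_list (parcs T) xs"
proof
  assume cyc: "cycle_list (parcs T) xs"
  \<comment> \<open>Repeating the first vertex at the end makes the closing arc appear in the zip,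
    which thus has as many arcs as \<open>xs\<close> has vertices.\<close>
  define ys where "ys = xs @ [hd xs]"
  have "xs \<noteq> []" using cyc by (auto simp: cycle_list_def)
  then have ys: "ys \<noteq> []" "hd ys = hd xs" "last ys = hd xs"
    by (auto simp: ys_def)
  have succ: "successively (\<lambda>x y. (x, y) \<in> parcs T) ys"
    using cyc by (auto simp: cycle_list_def ys_def successively_append_iff)
  have "hd xs \<in> pverts T"
    using cyc in_arcsD2 by (auto simp: cycle_list_def)
  moreover have "distinct (tl ys)"
    using cyc \<open>xs \<noteq> []\<close> by (cases xs) (auto simp: cycle_list_def ys_def)
  moreover have len: "length (zip ys (tl ys)) \<ge> 3"
    using cyc by (auto simp: cycle_list_def ys_def)
  ultimately have "cycle (zip ys (tl ys))"
    using pcas_zip_tl[OF ys(1)] pawalk_verts_zip_tl[OF ys(1)] set_zip_tl_subset[OF succ] ys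
    unfolding cycle_def awalk_def by (intro exI[of _ "hd xs"]) auto
  with len show False
    using tree by (auto simp: undirected_tree_def)
qed

lemma tree_two_colourable: "\<exists>c :: 'a \<Rightarrow> bool. \<forall>(x, y) \<in> parcs T. c x \<noteq> c y"
  using tree_sym tree_irrefl tree_no_cycle_list pair_finite_arcs
  by (intro acyclic_imp_two_colourable) (auto simp: sym_def irrefl_def)

text \<open>Otherwise \<open>u, a, v, b\<close> would be a 4-cycle.\<close>

lemma tree_common_nbhd:
  assumes "{a, b} \<subseteq> nbhd T u" "{a, b} \<subseteq> nbhd T v" "a \<noteq> b"
  shows "u = v"
proof (rule ccontr)
  assume "u \<noteq> v"
  with assms have "cycle_list (parcs T) [u, a, v, b]"
    using tree_irrefl by (auto simp: cycle_list_def nbhd_def intro: tree_sym)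
  then show False
    using tree_no_cycle_list by blast
qed

text \<open>A walk starting in \<open>A\<close> never leaves it. This is how connectedness enters:
  it identifies the whole tree when one or two vertices are closed under adjacency.\<close>

lemma tree_closed_eq_pverts:
  assumes "A \<subseteq> pverts T" "A \<noteq> {}" "\<And>u. u \<in> A \<Longrightarrow> nbhd T u \<subseteq> A"
  shows "A = pverts T"
proof
  obtain u where "u \<in> A" using assms by blast
  \<comment> \<open>Connectedness is strong connectedness of the symmetric closure, which adds no
    arcs here.\<close>
  have arcs: "parcs (mk_symmetric (with_proj T)) = parcs T"
    using tree_sym by (auto simp: parcs_mk_symmetric)
  show "pverts T \<subseteq> A"
  proof
    fix v assume "v \<in> pverts T"
    then have "u \<rightarrow>\<^sup>*\<^bsub>with_proj (mk_symmetric (with_proj T))\<^esub> v"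
      using tree \<open>u \<in> A\<close> assms(1)
      by (auto simp: undirected_tree_def connected_def strongly_connected_def)
    then have "(u, v) \<in> (parcs T)\<^sup>*"
      using reachable_rtranclI arcs by fastforce
    then show "v \<in> A"
      using \<open>u \<in> A\<close> assms(3) by induction (auto simp: nbhd_def)
  qed
qed (fact assms)

lemma nbhd_subset: "nbhd T u \<subseteq> pverts T"
  using in_arcsD2 by (auto simp: nbhd_def)

lemma finite_nbhd: "finite (nbhd T u)"
  using nbhd_subset pair_finite_verts finite_subset by blast

lemma leaf_nbhd:
  assumes "u \<in> leaves T" "(u, v) \<in> parcs T"
  shows "nbhd T u = {v}"
proof -
  have "card (nbhd T u) = 1" "v \<in> nbhd T u"
    using assms by (auto simp: leaves_def nbhd_def)
  then show ?thesis by (auto simp: card_1_singleton_iff)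
qed

section \<open>Leaves and degrees in trees of order at least two\<close>

context
  assumes order: "card (pverts T) \<ge> 2"
begin

lemma nbhd_nonempty:
  assumes "u \<in> pverts T"
  shows "nbhd T u \<noteq> {}"
proof
  assume "nbhd T u = {}"
  with assms have "{u} = pverts T"
    by (intro tree_closed_eq_pverts) auto
  then have "card (pverts T) = 1"
    by (metis is_singletonI is_singleton_altdef)
  with order show False by simp
qed

text \<open>Two adjacent leaves would make up the whole tree, and in the path on two vertices the
  convention admits only one leaf.\<close>

lemma leaf_not_support:
  assumes "u \<in> leaves T"
  shows "u \<notin> support_vertices T"
proof
  assume "u \<in> support_vertices T"
  then obtain v where v: "v \<in> leaves T" "(u, v) \<in> parcs T"
    by (auto simp: support_vertices_def)
  then have "nbhd T u = {v}" "nbhd T v = {u}"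
    using assms leaf_nbhd tree_sym by blast+
  then have "{u, v} = pverts T"
    using assms v by (intro tree_closed_eq_pverts) (auto simp: leaves_def)
  moreover have "u \<noteq> v" using v tree_irrefl by auto
  ultimately have "card (pverts T) = 2" "(SOME w. w \<in> pverts T) \<in> {u, v}"
    by (metis card_2_iff, metis insertI1 someI_ex)
  then show False
    using assms v by (auto simp: leaves_def)
qed

text \<open>A vertex of degree 1 that is not a leaf can only be the chosen vertex of the path on two
  vertices, and that one is a support vertex.\<close>

lemma inner_vertex_degree:
  assumes "u \<in> pverts T" "u \<notin> leaves T" "u \<notin> support_vertices T"
  shows "card (nbhd T u) \<ge> 2"
proof (rule ccontr)
  assume "\<not> card (nbhd T u) \<ge> 2"
  moreover have "card (nbhd T u) \<noteq> 0"
    using nbhd_nonempty[OF assms(1)] finite_nbhd by simp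
  ultimately have deg: "card (nbhd T u) = 1" by linarith
  with assms have two: "card (pverts T) = 2" and u: "u = (SOME v. v \<in> pverts T)"
    by (auto simp: leaves_def)
  from deg obtain v where v: "nbhd T u = {v}"
    by (auto simp: card_1_singleton_iff)
  then have uv: "(u, v) \<in> parcs T" by (auto simp: nbhd_def)
  then have "u \<noteq> v" using tree_irrefl by auto
  moreover have "v \<in> pverts T" using uv in_arcsD2 by blast
  ultimately have "pverts T = {u, v}"
    using two assms(1) by (auto simp: card_2_iff)
  then have "nbhd T v = {u}"
    using nbhd_subset[of v] tree_irrefl[of v] tree_sym[OF uv] by (auto simp: nbhd_def)
  then have "v \<in> leaves T"
    using u \<open>u \<noteq> v\<close> \<open>v \<in> pverts T\<close> by (auto simp: leaves_def)
  then show False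
    using assms uv by (auto simp: support_vertices_def)
qed

section \<open>Construction and size of the locating-dominating set\<close>

lemma ex_small_locating_dominating:
  "\<exists>S. locating_dominating T S \<and> 2 * card S + card (support_vertices T) +
     card (support_links T) \<le> card (pverts T) + card (leaves T)"
proof -
  define V L U X where "V = pverts T" and "L = leaves T" and "U = support_vertices T"
    and "X = support_links T"
  note defs = V_def L_def U_def X_def
  define R where "R = V - L - U - X"
  have fin: "finite V" using pair_finite_verts by (simp add: V_def)
  have sub: "L \<subseteq> V" "U \<subseteq> V" "X \<subseteq> V" "R \<subseteq> V"
    by (auto simp: defs R_def leaves_def support_vertices_def support_links_def)
  note finites = this[THEN finite_subset, OF fin]
  have disj: "L \<inter> U = {}" "(L \<union> U) \<inter> X = {}" "(L \<union> U \<union> X) \<inter> R = {}"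
    using leaf_not_support by (auto simp: defs R_def support_links_def)
  have "V = L \<union> U \<union> X \<union> R" using sub by (auto simp: R_def)
  then have card_V: "card V = card L + card U + card X + card R"
    using finites disj by (simp add: card_Un_disjoint)

  \<comment> \<open>\<open>f u\<close> is the leaf at \<open>u\<close> that is left out of
    \<open>S\<close>; its only neighbour is \<open>u\<close>, so \<open>f\<close> is injective on
    \<open>U\<close>.\<close>
  define f where "f u = (SOME l. l \<in> L \<and> (u, l) \<in> parcs T)" for u
  have f: "f u \<in> L \<and> (u, f u) \<in> parcs T" if "u \<in> U" for u
    unfolding f_def by (rule someI_ex) (use that in \<open>auto simp: U_def L_def support_vertices_def\<close>)
  have f_nbhd: "nbhd T (f u) = {u}" if "u \<in> U" for u
    using f[OF that] leaf_nbhd tree_sym by (auto simp: L_def)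
  have "inj_on f U"
    by (rule inj_onI) (metis f_nbhd singleton_inject)
  define K where "K = L - f ` U"
  have "f ` U \<subseteq> L" using f by auto
  then have card_K: "card K + card U = card L"
    unfolding K_def using finites card_mono[of L "f ` U"]
    by (simp add: card_Diff_subset card_image[OF \<open>inj_on f U\<close>])

  obtain c :: "'a \<Rightarrow> bool" where c: "\<And>x y. (x, y) \<in> parcs T \<Longrightarrow> c x \<noteq> c y"
    using tree_two_colourable by blast
  have "card {r \<in> R. c r} + card {r \<in> R. \<not> c r} = card R"
    using finites by (subst card_Un_disjoint[symmetric]) (auto intro!: arg_cong[of _ _ card])
  then have "\<exists>b. 2 * card {r \<in> R. c r = b} \<le> card R"
    by (cases "card {r \<in> R. c r} \<le> card {r \<in> R. \<not> c r}")
      (auto intro: exI[of _ True] exI[of _ False])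
  then obtain b where b: "2 * card {r \<in> R. c r = b} \<le> card R" ..
  define D where "D = {r \<in> R. c r = b}"
  define S where "S = U \<union> K \<union> D"

  have "card S \<le> card U + card K + card D"
    unfolding S_def by (meson add_mono card_Un_le le_refl le_trans)
  then have "2 * card S + card U + card X \<le> card V + card L"
    using b card_K card_V unfolding D_def by linarith

  moreover have "locating_dominating T S"
  proof -
    \<comment> \<open>With the whole neighbourhood inside \<open>S\<close>, intersecting with
      \<open>S\<close> changes nothing: it remains to see that neighbourhoods are nonempty and
      distinct.\<close>
    have outside: "nbhd T w \<subseteq> S \<and> (w \<in> f ` U \<or> card (nbhd T w) \<ge> 2)" if w: "w \<in> V - S" for w
    proof (cases "w \<in> L")
      case True
      then have "w \<in> f ` U" using w by (auto simp: S_def K_def)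
      then show ?thesis using f_nbhd by (auto simp: S_def)
    next
      case False
      have "nbhd T w \<subseteq> S"
      proof (cases "w \<in> X")
        case True
        then show ?thesis by (auto simp: defs S_def support_links_def)
      next
        case False
        with w \<open>w \<notin> L\<close> have "w \<in> R" "c w \<noteq> b"
          by (auto simp: S_def D_def R_def)
        show ?thesis
        proof
          fix x assume "x \<in> nbhd T w"
          then have wx: "(w, x) \<in> parcs T" by (simp add: nbhd_def)
          then have "x \<in> V" using in_arcsD2 by (simp add: V_def)
          \<comment> \<open>A leaf or a support link as neighbour would make \<open>w\<close> a
            support vertex. So \<open>x\<close> lies in \<open>U\<close> or in \<open>R\<close>, and
            in the latter case its colour puts it in \<open>D\<close>.\<close>
          moreover have "x \<notin> L"
            using wx \<open>w \<in> R\<close> by (auto simp: defs R_def support_vertices_def)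
          moreover have "x \<notin> X"
            using tree_sym[OF wx] \<open>w \<in> R\<close> by (auto simp: defs R_def support_links_def nbhd_def)
          moreover have "c x = b"
            using c[OF wx] \<open>c w \<noteq> b\<close> by blast
          ultimately show "x \<in> S" by (auto simp: S_def D_def R_def)
        qed
      qed
      moreover have "card (nbhd T w) \<ge> 2"
        using w False by (intro inner_vertex_degree) (auto simp: defs S_def)
      ultimately show ?thesis by blast
    qed
    have "S \<subseteq> V" using sub by (auto simp: S_def K_def D_def)
    moreover have "nbhd T w \<inter> S \<noteq> {}" if "w \<in> V - S" for w
      using outside[OF that] nbhd_nonempty[of w] that by (auto simp: V_def)
    moreover have "w = w'"
      if w: "w \<in> V - S" and w': "w' \<in> V - S" and eq: "nbhd T w \<inter> S = nbhd T w' \<inter> S" for w w'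
    proof -
      have eq': "nbhd T w = nbhd T w'"
        using outside[OF w] outside[OF w'] eq by blast
      show ?thesis
      proof (cases "card (nbhd T w) \<ge> 2")
        case True
        then obtain x y where "{x, y} \<subseteq> nbhd T w" "x \<noteq> y"
          by (metis card_2_iff obtain_subset_with_card_n)
        then show ?thesis
          using tree_common_nbhd eq' by metis
      next
        case False
        \<comment> \<open>Both vertices are left-out leaves, and their common neighbourhood is the
          singleton of the support vertex of each.\<close>
        then obtain u u' where "u \<in> U" "w = f u" "u' \<in> U" "w' = f u'"
          using outside[OF w] outside[OF w'] eq' by auto
        then show ?thesis
          using f_nbhd eq' by (metis singleton_inject)
      qed
    qed
    ultimately show ?thesis
      unfolding locating_dominating_def V_def by blast
  qed
  ultimately show ?thesis
    unfolding defs by blast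
qed

end

end

theorem theorem17:
  fixes T :: "'a pair_pre_digraph"
  assumes "undirected_tree T"
    and "card (pverts T) \<ge> 2"
  shows "real (ld_number T) \<le>
    (real (card (pverts T)) + real (card (leaves T))
      - real (card (support_vertices T)) - real (card (support_links T))) / 2"
proof -
  obtain S where S: "locating_dominating T S"
    and card: "2 * card S + card (support_vertices T) + card (support_links T)
      \<le> card (pverts T) + card (leaves T)"
    using ex_small_locating_dominating[OF assms] by blast
  have "ld_number T \<le> card S"
    unfolding ld_number_def using S by (intro Least_le) blast
  with card have "2 * ld_number T + card (support_vertices T) + card (support_links T)
      \<le> card (pverts T) + card (leaves T)"
    by linarith
  then show ?thesis
    unfolding of_nat_le_iff[where 'a = real, symmetric] by simp
qed

end
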